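(* Let $r\geq 4$ be a fixed integer. There exists $n_0=n_0(r)$ such that for every $n\ge n_0$ and every bijection $f$ from the vertex set of $K(n,r)$ to $\{1,\ldots,\binom{n}{r}\}$, $$\mathrm{dilation}(f)\geq \binom{n}{r}-\frac{1}{2}\binom{n-1}{r-1}-2\frac{n^{r-2}}{(r-2)!}+\frac{r+2}{(r-3)!}\, n^{r-3}-9r^4 n^{r-4}.$$
   Context: For integers $n\ge r\ge 1$, the Kneser graph $K(n,r)$ has as vertex set the family of all $r$-element subsets of $[n]=\{1,\dots,n\}$, two vertices being adjacent iff the corresponding $r$-sets are disjoint. For a graph $G=(V,E)$ on $N$ vertices and a bijection $f:V\to\{1,\dots,N\}$, $\mathrm{dilation}(f)=\max\{|f(v)-f(w)| : vw\in E\}$. *)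

theory Defs
  imports Complex_Main "Graph_Theory.Pair_Digraph"
begin

text \<open>An undirected simple graph is represented, as in \<open>pair_graph\<close>, by a symmetric irreflexive
  arc relation: an edge \<open>vw\<close> is the pair of arcs \<open>(v, w)\<close> and \<open>(w, v)\<close>.\<close>

definition kneser_graph :: "nat \<Rightarrow> nat \<Rightarrow> nat set pair_pre_digraph" where
  "kneser_graph n r =
     (let V = {A. A \<subseteq> {1..n} \<and> card A = r}
      in \<lparr>pverts = V, parcs = {(A, B). A \<in> V \<and> B \<in> V \<and> A \<inter> B = {}}\<rparr>)"

lemma pair_graph_kneser_graph:
  assumes "r \<ge> 1"
  shows "pair_graph (kneser_graph n r)"
proof -
  let ?V = "{A. A \<subseteq> {1..n} \<and> card A = r}"
  have fin: "finite ?V"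
    by (rule finite_subset[of _ "Pow {1..n}"]) auto
  have V: "pverts (kneser_graph n r) = ?V"
    by (simp only: kneser_graph_def Let_def pair_pre_digraph.simps)
  have E: "(A, B) \<in> parcs (kneser_graph n r) \<longleftrightarrow> A \<in> ?V \<and> B \<in> ?V \<and> A \<inter> B = {}" for A B
    by (simp only: kneser_graph_def Let_def pair_pre_digraph.simps mem_Collect_eq case_prod_conv)
  show ?thesis
  proof
    fix e assume e: "e \<in> parcs (kneser_graph n r)"
    obtain A B where AB: "e = (A, B)" by (cases e)
    show "fst e \<in> pverts (kneser_graph n r)" "snd e \<in> pverts (kneser_graph n r)"
      using e unfolding AB E V by simp_all
    have "A \<inter> B = {}" "card A = r"
      using e unfolding AB E by simp_all
    then show "fst e \<noteq> snd e"
      using assms unfolding AB by auto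
  next
    show "finite (pverts (kneser_graph n r))"
      unfolding V by (fact fin)
    have "parcs (kneser_graph n r) \<subseteq> ?V \<times> ?V"
      by (rule subrelI) (simp only: E mem_Sigma_iff)
    then show "finite (parcs (kneser_graph n r))"
      by (rule finite_subset) (rule finite_cartesian_product[OF fin fin])
    have "sym (parcs (kneser_graph n r))"
      by (intro symI) (auto simp only: E Int_commute)
    then show "symmetric (kneser_graph n r)"
      by (simp add: symmetric_def)
  qed
qed

text \<open>The values are taken in \<open>int\<close>, since subtraction on \<open>nat\<close> truncates. The maximum is meaningful
  only for a graph with finitely many edges and at least one (for \<open>kneser_graph n r\<close> with
  \<open>r \<ge> 1\<close>: when \<open>n \<ge> 2 * r\<close>); otherwise \<open>Max\<close> is unspecified.\<close>

definition dilation :: "'a pair_pre_digraph \<Rightarrow> ('a \<Rightarrow> nat) \<Rightarrow> int" where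
  "dilation G f = Max {\<bar>int (f v) - int (f w)\<bar> | v w. (v, w) \<in> parcs G}"

end

theory Submission
  imports Defs
begin

text \<open>Let \<open>N = n choose r\<close> and let \<open>m\<close> be \<open>N\<close> minus the dilation. Write \<open>v i\<close> for the \<open>i\<close>-th set and
  \<open>w j\<close> for the \<open>j\<close>-th set from the end. If \<open>i + j \<le> m\<close>, the two are too far apart to be
  adjacent, so they intersect. When \<open>m\<close> is much larger than \<open>n ^ (r - 2)\<close>, the sets \<open>v i\<close> and \<open>w j\<close>
  with \<open>i, j \<le> m / 2\<close> all contain a common point \<open>x\<close>. If \<open>P\<close> of the \<open>v i\<close> and \<open>Q\<close> of the \<open>w j\<close> with
  \<open>i, j \<le> m\<close> miss \<open>x\<close>, then \<open>2 m \<le> (n - 1 choose r - 1) + P + Q\<close>, since all these sets are distinct.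

  The first \<open>k\<close> of the sets \<open>v i\<close> missing \<open>x\<close> all meet the first \<open>P - k\<close> of the \<open>w j\<close>.
  For \<open>k\<close> slightly above \<open>2 (n - 4 choose r - 3)\<close>, this forces almost all of these \<open>w j\<close> (up to
  \<open>O (n ^ (r - 4))\<close>) to meet one pair \<open>{y, z}\<close>, unless \<open>P\<close> is smaller than needed anyway.
  Symmetrically \<open>Q\<close> yields a pair \<open>{y', z'}\<close>. The \<open>v i\<close> and \<open>w j\<close> that meet their pairs are distinct
  sets through \<open>x\<close> meeting \<open>{y, z, y', z'}\<close>, so that they number at most
  \<open>(n - 1 choose r - 1) - (n - 5 choose r - 1)\<close>; up to \<open>O (n ^ (r - 4))\<close>, the
  overlap of the families of the two pairs compensates the loss \<open>2 k\<close>.\<close>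

section \<open>Families of \<open>r\<close>-sets and their codegrees\<close>

definition ksets :: "'a set \<Rightarrow> nat \<Rightarrow> 'a set set" where
  "ksets U r = {A. A \<subseteq> U \<and> card A = r}"

definition codeg :: "'a set set \<Rightarrow> 'a set \<Rightarrow> nat" where
  "codeg G T = card {w \<in> G. T \<subseteq> w}"

lemma finite_ksets: "finite U \<Longrightarrow> finite (ksets U r)"
  unfolding ksets_def by (rule finite_subset[of _ "Pow U"]) auto

lemma codeg_ksets:
  assumes U: "finite U" and T: "T \<subseteq> U" "card T \<le> r"
  shows "codeg (ksets U r) T = (card U - card T) choose (r - card T)"
proof -
  have fT: "finite T" using U T finite_subset by blast
  have "bij_betw (\<lambda>w. w - T) {w \<in> ksets U r. T \<subseteq> w} {B. B \<subseteq> U - T \<and> card B = r - card T}"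
  proof (rule bij_betw_byWitness[where f' = "\<lambda>B. B \<union> T"])
    show "(\<lambda>w. w - T) ` {w \<in> ksets U r. T \<subseteq> w} \<subseteq> {B. B \<subseteq> U - T \<and> card B = r - card T}"
      using fT by (auto simp: ksets_def card_Diff_subset)
    show "(\<lambda>B. B \<union> T) ` {B. B \<subseteq> U - T \<and> card B = r - card T} \<subseteq> {w \<in> ksets U r. T \<subseteq> w}"
    proof clarsimp
      fix B assume B: "B \<subseteq> U - T" "card B = r - card T"
      then have "finite B" using U finite_subset by blast
      then have "card (B \<union> T) = card B + card T"
        using B fT by (intro card_Un_disjoint) auto
      then show "B \<union> T \<in> ksets U r"
        using B T by (auto simp: ksets_def)
    qed
  qed auto
  then have "codeg (ksets U r) T = card {B. B \<subseteq> U - T \<and> card B = r - card T}"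
    unfolding codeg_def by (rule bij_betw_same_card)
  also have "\<dots> = card (U - T) choose (r - card T)"
    using U by (intro n_subsets) auto
  also have "card (U - T) = card U - card T"
    using fT T by (simp add: card_Diff_subset)
  finally show ?thesis .
qed

lemma card_le_split: "card G \<le> card {A \<in> G. Q A} + card {A \<in> G. \<not> Q A}"
proof -
  have "{A \<in> G. Q A} \<union> {A \<in> G. \<not> Q A} = G" by auto
  then show ?thesis
    using card_Un_le[of "{A \<in> G. Q A}" "{A \<in> G. \<not> Q A}"] by (simp only:)
qed

lemma codeg_mono: "G \<subseteq> H \<Longrightarrow> finite H \<Longrightarrow> codeg G T \<le> codeg H T"
  unfolding codeg_def by (rule card_mono) auto

lemma codeg_le_choose:
  assumes U: "finite U" and G: "G \<subseteq> ksets U r" and T: "card T \<le> r"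
  shows "codeg G T \<le> (card U - card T) choose (r - card T)"
proof (cases "T \<subseteq> U")
  case True
  then show ?thesis
    using codeg_mono[OF G finite_ksets[OF U]] codeg_ksets[OF U True T] by metis
next
  case False
  then have "{w \<in> G. T \<subseteq> w} = {}" using G by (auto simp: ksets_def)
  then show ?thesis by (simp add: codeg_def del: Collect_empty_eq)
qed

lemma choose_le_power: "(n choose k) \<le> n ^ k"
  by (cases "k \<le> n") (auto intro: binomial_le_pow simp: binomial_eq_0)

lemma codeg_le_power:
  assumes "finite U" and "G \<subseteq> ksets U r" and "card T \<le> r"
  shows "codeg G T \<le> card U ^ (r - card T)"
proof -
  have "codeg G T \<le> (card U - card T) ^ (r - card T)"
    using codeg_le_choose[OF assms] choose_le_power order_trans by blast
  also have "\<dots> \<le> card U ^ (r - card T)"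
    by (rule power_mono) auto
  finally show ?thesis .
qed

section \<open>Branching and cross-intersecting families\<close>

text \<open>Each member of \<open>G\<close> above \<open>T\<close> contains a point of
  \<open>A\<close>, so it lies above some \<open>insert p T\<close>. For an \<open>r\<close>-set
  \<open>A\<close> disjoint from \<open>T\<close>, one application replaces a factor
  \<open>card U\<close> of the trivial bound on the codegree by \<open>r\<close>; the next
  \<open>A\<close> may depend on the points added before.\<close>

lemma codeg_branch:
  assumes G: "finite G" and A: "finite A" "\<And>w. w \<in> G \<Longrightarrow> A \<inter> w \<noteq> {}"
    and c: "\<And>p. p \<in> A \<Longrightarrow> codeg G (insert p T) \<le> c"
  shows "codeg G T \<le> card A * c"
proof -
  have "{w \<in> G. T \<subseteq> w} \<subseteq> (\<Union>p\<in>A. {w \<in> G. insert p T \<subseteq> w})"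
    using A(2) by auto
  then have "codeg G T \<le> card (\<Union>p\<in>A. {w \<in> G. insert p T \<subseteq> w})"
    unfolding codeg_def using G A by (intro card_mono) auto
  also have "\<dots> \<le> (\<Sum>p\<in>A. codeg G (insert p T))"
    unfolding codeg_def by (rule card_UN_le[OF A(1)])
  also have "\<dots> \<le> card A * c"
    using sum_bounded_above[of A "\<lambda>p. codeg G (insert p T)" c] c by simp
  finally show ?thesis .
qed

lemma codeg_eq_0:
  assumes "\<And>w. w \<in> G \<Longrightarrow> p \<notin> w" and "p \<in> T"
  shows "codeg G T = 0"
proof -
  have "{w \<in> G. T \<subseteq> w} = {}" using assms by auto
  then show ?thesis by (simp add: codeg_def del: Collect_empty_eq)
qed

text \<open>The threshold on \<open>card F\<close> excludes a two-point cover of \<open>F\<close> by points other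
  than two common ones: the sets of \<open>F\<close> through three given points number at most
  \<open>(n - 4) choose (r - 3)\<close>.\<close>

lemma cross_intersecting_star_structure:
  fixes U :: "'a set"
  assumes U: "finite U" "x \<in> U" and r: "r \<ge> 4"
    and F: "F \<subseteq> ksets (U - {x}) r" "card F = 2 * ((card U - 4) choose (r - 3)) + 1"
    and G: "G \<subseteq> ksets U r" "\<And>w. w \<in> G \<Longrightarrow> x \<in> w"
    and FG: "\<And>A w. A \<in> F \<Longrightarrow> w \<in> G \<Longrightarrow> A \<inter> w \<noteq> {}"
  shows "(\<exists>y z. y \<in> U - {x} \<and> z \<in> U - {x} \<and>
            card {w \<in> G. y \<notin> w \<and> z \<notin> w} \<le> r ^ 3 * card U ^ (r - 4))
       \<or> card G \<le> ((card U - 2) choose (r - 2)) + r ^ 2 * card U ^ (r - 3)"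
proof -
  have finG: "finite G" using G(1) finite_ksets U(1) finite_subset by blast
  have finF: "finite F" using F(1) finite_ksets U(1) finite_subset by (metis finite_Diff)
  have FD: "finite A" "card A = r" "x \<notin> A" "A \<subseteq> U" if "A \<in> F" for A
    using that F(1) U(1) by (auto simp: ksets_def intro: finite_subset)
  have card3: "card {A \<in> F. T \<subseteq> A} \<le> (card U - 4) choose (r - 3)" if "card T = 3" for T
    using codeg_le_choose[of "U - {x}" F r T] F(1) U r that by (simp add: codeg_def)
  have Fne: "F \<noteq> {}" using F(2) by auto
  define I where "I = \<Inter>F"
  have IU: "I \<subseteq> U - {x}" using Fne FD unfolding I_def by blast
  have finI: "finite I" using IU U(1) finite_subset by blast
  have escape: "\<exists>A\<in>F. p \<notin> A" if "p \<notin> I" for p using that unfolding I_def by auto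
  \<comment> \<open>Three common points would place the whole of \<open>F\<close> above a single
    triple, against \<open>card3\<close>.\<close>
  have I2: "card I \<le> 2"
  proof (rule ccontr)
    assume "\<not> card I \<le> 2"
    then obtain T where T: "T \<subseteq> I" "card T = 3"
      using obtain_subset_with_card_n[of 3 I] by auto
    then have "{A \<in> F. T \<subseteq> A} = F" unfolding I_def by auto
    then show False using card3[OF T(2)] F(2) by simp
  qed
  \<comment> \<open>Two branchings: over any member of \<open>F\<close>, then over one missing the
    point just chosen. A common point has no such second member, so \<open>out\<close> demands that
    its branch be empty.\<close>
  have branch2: "codeg H {x} \<le> r * (r * card U ^ (r - 3))"
    if H: "H \<subseteq> G" and out: "\<And>p. p \<in> I \<Longrightarrow> codeg H {x, p} = 0" for H
  proof -
    have finH: "finite H" using H finG finite_subset by blast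
    have HU: "H \<subseteq> ksets U r" using H G by auto
    obtain A where A: "A \<in> F" using Fne by auto
    have "codeg H {x} \<le> card A * (r * card U ^ (r - 3))"
    proof (rule codeg_branch[OF finH])
      show "finite A" using FD A by auto
      show "A \<inter> w \<noteq> {}" if "w \<in> H" for w using FG A H that by blast
      fix p assume p: "p \<in> A"
      show "codeg H (insert p {x}) \<le> r * card U ^ (r - 3)"
      proof (cases "p \<in> I")
        case True
        then show ?thesis using out by (simp add: insert_commute)
      next
        case False
        then obtain B where B: "B \<in> F" "p \<notin> B" using escape by blast
        have "codeg H (insert p {x}) \<le> card B * card U ^ (r - 3)"
        proof (rule codeg_branch[OF finH])
          show "finite B" using FD B by auto
          show "B \<inter> w \<noteq> {}" if "w \<in> H" for w using FG B H that by blast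
          fix q assume q: "q \<in> B"
          have "card {q, p, x} = 3" using p q B FD A by (auto simp: card_insert_if)
          then show "codeg H (insert q (insert p {x})) \<le> card U ^ (r - 3)"
            using codeg_le_power[OF U(1) HU, of "{q, p, x}"] r by simp
        qed
        then show ?thesis using FD B by simp
      qed
    qed
    then show ?thesis using FD A by simp
  qed
  have codeg_x: "codeg H {x} = card H" if "H \<subseteq> G" for H
  proof -
    have "{w \<in> H. {x} \<subseteq> w} = H" using that G(2) by auto
    then show ?thesis by (simp add: codeg_def)
  qed
  \<comment> \<open>The number of common points decides: two of them give the pair \<open>y\<close>,
    \<open>z\<close>; with one or none, \<open>G\<close> itself is small.\<close>
  consider (two) y z where "I = {y, z}" "y \<noteq> z" | (one) y where "I = {y}" | (none) "I = {}"
  proof -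
    have "card I = 0 \<or> card I = 1 \<or> card I = 2" using I2 by linarith
    then show ?thesis
      using that finI by (auto simp: card_1_singleton_iff card_2_iff)
  qed
  then show ?thesis
  proof cases
    case two
    define H where "H = {w \<in> G. y \<notin> w \<and> z \<notin> w}"
    have HG: "H \<subseteq> G" unfolding H_def by auto
    have finH: "finite H" using HG finG finite_subset by blast
    have HU: "H \<subseteq> ksets U r" using HG G by auto
    \<comment> \<open>Branches at common points vanish in \<open>H\<close>, which leaves room for a
      third branching elsewhere.\<close>
    have zero: "codeg H T = 0" if "p \<in> I" "p \<in> T" for p T
      by (rule codeg_eq_0[of _ p]) (use that two in \<open>auto simp: H_def\<close>)
    obtain A where A: "A \<in> F" using Fne by auto
    have "codeg H {x} \<le> card A * (r * (r * card U ^ (r - 4)))"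
    proof (rule codeg_branch[OF finH])
      show "finite A" using FD A by auto
      show "A \<inter> w \<noteq> {}" if "w \<in> H" for w using FG A HG that by blast
      fix p assume p: "p \<in> A"
      show "codeg H (insert p {x}) \<le> r * (r * card U ^ (r - 4))"
      proof (cases "p \<in> I")
        case True
        then show ?thesis using zero[of p] by simp
      next
        case pI: False
        then obtain B where B: "B \<in> F" "p \<notin> B" using escape by blast
        have "codeg H (insert p {x}) \<le> card B * (r * card U ^ (r - 4))"
        proof (rule codeg_branch[OF finH])
          show "finite B" using FD B by auto
          show "B \<inter> w \<noteq> {}" if "w \<in> H" for w using FG B HG that by blast
          fix q assume q: "q \<in> B"
          show "codeg H (insert q (insert p {x})) \<le> r * card U ^ (r - 4)"
          proof (cases "q \<in> I")
            case True
            then show ?thesis using zero[of q] by simp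
          next
            case qI: False
            \<comment> \<open>The third branching needs a member missing both \<open>p\<close> and
              \<open>q\<close>. Without one, every member contains \<open>y\<close>,
              \<open>z\<close> and one of \<open>p\<close>, \<open>q\<close>; two triples then
              account for all of \<open>F\<close>, which the \<open>+ 1\<close> in its size
              forbids.\<close>
            have "\<exists>C\<in>F. p \<notin> C \<and> q \<notin> C"
            proof (rule ccontr)
              assume "\<not> ?thesis"
              then have "F \<subseteq> {A \<in> F. {y, z, p} \<subseteq> A} \<union> {A \<in> F. {y, z, q} \<subseteq> A}"
                using two(1) unfolding I_def by auto
              then have "card F \<le> card ({A \<in> F. {y, z, p} \<subseteq> A} \<union> {A \<in> F. {y, z, q} \<subseteq> A})"
                by (rule card_mono[rotated]) (use finF in auto)
              also have "\<dots> \<le> card {A \<in> F. {y, z, p} \<subseteq> A} + card {A \<in> F. {y, z, q} \<subseteq> A}"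
                by (rule card_Un_le)
              also have "\<dots> \<le> 2 * ((card U - 4) choose (r - 3))"
                using card3[of "{y, z, p}"] card3[of "{y, z, q}"] two pI qI by auto
              finally show False using F(2) by simp
            qed
            then obtain C where C: "C \<in> F" "p \<notin> C" "q \<notin> C" by blast
            have "codeg H (insert q (insert p {x})) \<le> card C * card U ^ (r - 4)"
            proof (rule codeg_branch[OF finH])
              show "finite C" using FD C by auto
              show "C \<inter> w \<noteq> {}" if "w \<in> H" for w using FG C HG that by blast
              fix s assume s: "s \<in> C"
              have "s \<noteq> x" "q \<noteq> x" "p \<noteq> x" "s \<noteq> q" "s \<noteq> p" "q \<noteq> p"
                using s q p A B C FD by auto
              then have "card {s, q, p, x} = 4" by simp
              then show "codeg H (insert s (insert q (insert p {x}))) \<le> card U ^ (r - 4)"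
                using codeg_le_power[OF U(1) HU, of "{s, q, p, x}"] r by simp
            qed
            then show ?thesis using FD C by simp
          qed
        qed
        then show ?thesis using FD B by simp
      qed
    qed
    then have "card H \<le> r ^ 3 * card U ^ (r - 4)"
      using codeg_x[OF HG] FD A by (simp add: power3_eq_cube mult.assoc)
    then show ?thesis using two IU unfolding H_def by blast
  next
    case one
    \<comment> \<open>Members through \<open>y\<close> are counted by the pair
      \<open>{x, y}\<close>; the others form \<open>H\<close>, where two branchings apply.\<close>
    define H where "H = {w \<in> G. y \<notin> w}"
    have HG: "H \<subseteq> G" unfolding H_def by auto
    have "codeg H {x, p} = 0" if "p \<in> I" for p
      by (rule codeg_eq_0[of _ p]) (use that one in \<open>auto simp: H_def\<close>)
    then have "card H \<le> r * (r * card U ^ (r - 3))"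
      using branch2[OF HG] codeg_x[OF HG] by auto
    moreover have "codeg G {x, y} \<le> (card U - 2) choose (r - 2)"
      using codeg_le_choose[OF U(1) G(1), of "{x, y}"] one IU r by (auto simp: numeral_2_eq_2)
    moreover have "card G \<le> codeg G {x, y} + card H"
    proof -
      have "{w \<in> G. {x, y} \<subseteq> w} = {w \<in> G. y \<in> w}" using G(2) by auto
      then show ?thesis
        unfolding codeg_def H_def using card_le_split[of G "\<lambda>w. y \<in> w"] by (simp only:)
    qed
    ultimately show ?thesis by (simp add: power2_eq_square mult.assoc)
  next
    case none
    then show ?thesis
      using branch2[of G] codeg_x[of G] by (simp add: power2_eq_square mult.assoc)
  qed
qed

section \<open>Sequences of sets read from opposite ends of the ordering\<close>

text \<open>The count grows by at most one with \<open>t\<close>, so it takes every value up to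
  \<open>card J\<close>. This cuts a sequence exactly where \<open>k\<close> sets missing
  \<open>x\<close> have appeared.\<close>

lemma ex_initial_segment_card:
  fixes J :: "nat set"
  assumes "J \<subseteq> {1..m}" and "k \<le> card J"
  shows "\<exists>t\<le>m. card (J \<inter> {1..t}) = k"
  using assms
proof (induction m arbitrary: J)
  case 0
  then show ?case by auto
next
  case (Suc m)
  show ?case
  proof (cases "card J = k")
    case True
    then show ?thesis using Suc.prems by (intro exI[of _ "Suc m"]) (simp add: Int_absorb2)
  next
    case False
    have "finite J" using Suc.prems(1) finite_subset by blast
    have "J \<subseteq> insert (Suc m) (J \<inter> {1..m})" using Suc.prems(1) by (auto simp: le_Suc_eq)
    then have "card J \<le> card (insert (Suc m) (J \<inter> {1..m}))" by (intro card_mono) auto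
    also have "\<dots> = Suc (card (J \<inter> {1..m}))" by simp
    finally have "k \<le> card (J \<inter> {1..m})" using False Suc.prems(2) by linarith
    then obtain t where "t \<le> m" "card (J \<inter> {1..m} \<inter> {1..t}) = k"
      using Suc.IH[of "J \<inter> {1..m}"] by auto
    moreover have "J \<inter> {1..m} \<inter> {1..t} = J \<inter> {1..t}" using \<open>t \<le> m\<close> by auto
    ultimately show ?thesis by (intro exI[of _ t]) auto
  qed
qed

text \<open>Some point \<open>x\<close> of a member of \<open>B\<close> lies in more than
  \<open>r * card U ^ (r - 2)\<close> sets of \<open>A\<close>. A member of \<open>B\<close> missing
  \<open>x\<close> would meet all of these and, by branching, allow fewer; so \<open>x\<close> lies
  in all of \<open>B\<close>. Since \<open>B\<close> is then a large star at \<open>x\<close>, the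
  same argument puts \<open>x\<close> into all of \<open>A\<close>.\<close>

lemma large_cross_intersecting_star:
  assumes U: "finite U" and r: "r \<ge> 2"
    and A: "A \<subseteq> ksets U r" "card A > r ^ 2 * card U ^ (r - 2)"
    and B: "B \<subseteq> ksets U r" "card B > r ^ 2 * card U ^ (r - 2)"
    and AB: "\<And>a b. a \<in> A \<Longrightarrow> b \<in> B \<Longrightarrow> a \<inter> b \<noteq> {}"
  shows "\<exists>x\<in>U. (\<forall>a\<in>A. x \<in> a) \<and> (\<forall>b\<in>B. x \<in> b)"
proof -
  have small: "codeg G {x} \<le> r * card U ^ (r - 2)"
    if G: "G \<subseteq> ksets U r" and b: "b \<in> ksets U r" "x \<notin> b" "\<And>a. a \<in> G \<Longrightarrow> b \<inter> a \<noteq> {}" for G x b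
  proof -
    have "codeg G {x} \<le> card b * card U ^ (r - 2)"
    proof (rule codeg_branch)
      show "finite G" using G U finite_ksets finite_subset by blast
      show "finite b" using b U by (auto simp: ksets_def intro: finite_subset)
      show "b \<inter> a \<noteq> {}" if "a \<in> G" for a using b that by blast
      show "codeg G (insert p {x}) \<le> card U ^ (r - 2)" if "p \<in> b" for p
      proof -
        have "p \<noteq> x" using that b(2) by blast
        then have "card {p, x} = 2" by simp
        then show ?thesis using codeg_le_power[OF U G, of "{p, x}"] r by simp
      qed
    qed
    then show ?thesis using b by (simp add: ksets_def)
  qed
  have Bne: "B \<noteq> {}" using B by auto
  then obtain b0 where b0: "b0 \<in> B" by auto
  have b0': "finite b0" "card b0 = r" "b0 \<subseteq> U"
    using b0 B U by (auto simp: ksets_def intro: finite_subset)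
  have finA: "finite A" using A U finite_ksets finite_subset by blast
  have "\<exists>x\<in>b0. codeg A {x} > r * card U ^ (r - 2)"
  proof (rule ccontr)
    assume "\<not> ?thesis"
    moreover have "b0 \<inter> a \<noteq> {}" if "a \<in> A" for a using AB[OF that b0] by blast
    ultimately have "codeg A {} \<le> card b0 * (r * card U ^ (r - 2))"
      by (intro codeg_branch finA b0'(1)) (auto simp: not_less)
    then show False using A(2) b0' by (simp add: codeg_def power2_eq_square mult.assoc)
  qed
  then obtain x where x: "x \<in> b0" "codeg A {x} > r * card U ^ (r - 2)" by blast
  have xB: "x \<in> b" if "b \<in> B" for b
  proof (rule ccontr)
    assume "x \<notin> b"
    then have "codeg A {x} \<le> r * card U ^ (r - 2)"
      using that A B AB by (intro small[of A b x]) blast+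
    then show False using x by linarith
  qed
  have xA: "x \<in> a" if a: "a \<in> A" for a
  proof (rule ccontr)
    assume "x \<notin> a"
    then have "codeg B {x} \<le> r * card U ^ (r - 2)"
      using a A B AB by (intro small[of B a x]) blast+
    moreover have "codeg B {x} = card B"
    proof -
      have "{w \<in> B. {x} \<subseteq> w} = B" using xB by auto
      then show ?thesis by (simp add: codeg_def)
    qed
    moreover have "r * card U ^ (r - 2) \<le> r ^ 2 * card U ^ (r - 2)"
      by (simp add: power2_eq_square)
    ultimately show False using B(2) by linarith
  qed
  show ?thesis using x xA xB b0' by blast
qed

text \<open>The two bounds are the two outcomes of \<open>cross_intersecting_star_structure\<close>,
  read as bounds on \<open>P - k\<close>. Only the \<open>w j\<close> with \<open>j \<le> h\<close>
  are known to contain \<open>x\<close>; the size of \<open>h\<close> shows afterwards that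
  \<open>P - k < h\<close>, so these suffice.\<close>

lemma card_missing_star:
  fixes U :: "'a set" and v w :: "nat \<Rightarrow> 'a set"
  assumes U: "finite U" "x \<in> U" and r: "r \<ge> 4"
    and v: "inj_on v {1..m}" "v ` {1..m} \<subseteq> ksets U r"
    and w: "inj_on w {1..m}" "w ` {1..m} \<subseteq> ksets U r"
    and vw: "\<And>i j. 1 \<le> i \<Longrightarrow> 1 \<le> j \<Longrightarrow> i + j \<le> m \<Longrightarrow> v i \<inter> w j \<noteq> {}"
    and star: "\<And>j. 1 \<le> j \<Longrightarrow> j \<le> h \<Longrightarrow> x \<in> w j" and h: "h \<le> m"
    and hbig: "h > (r ^ 3 + 2) * card U ^ (r - 2)"
  defines "P \<equiv> card {i \<in> {1..m}. x \<notin> v i}"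
    and "k \<equiv> 2 * ((card U - 4) choose (r - 3)) + 1"
  shows "(\<exists>y z. y \<in> U - {x} \<and> z \<in> U - {x} \<and>
            P \<le> k + card {A \<in> w ` {1..m}. x \<in> A \<and> (y \<in> A \<or> z \<in> A)} + r ^ 3 * card U ^ (r - 4))
       \<or> P \<le> k + ((card U - 2) choose (r - 2)) + r ^ 2 * card U ^ (r - 3)"
proof (cases "k \<le> P")
  case False
  then show ?thesis by auto
next
  case True
  define J where "J = {i \<in> {1..m}. x \<notin> v i}"
  have "J \<subseteq> {1..m}" unfolding J_def by auto
  have PJ: "P = card J" unfolding P_def J_def by simp
  obtain t where t: "t \<le> m" "card (J \<inter> {1..t}) = k"
    using ex_initial_segment_card[of J m k] True PJ \<open>J \<subseteq> {1..m}\<close> by auto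
  \<comment> \<open>Beyond \<open>t\<close> only \<open>m - t\<close> indices remain, so
    \<open>j \<le> P - k\<close> implies \<open>i + j \<le> m\<close> for every
    \<open>i \<le> t\<close>.\<close>
  have "card J \<le> card ((J \<inter> {1..t}) \<union> {t<..m})"
    by (rule card_mono) (use \<open>J \<subseteq> {1..m}\<close> in auto)
  also have "\<dots> \<le> k + (m - t)" using card_Un_le[of "J \<inter> {1..t}" "{t<..m}"] t by simp
  finally have Pk: "P - k \<le> m - t" using PJ by linarith
  \<comment> \<open>Capping at \<open>h\<close> keeps \<open>G\<close> inside the known star; the
    size bounds below exclude \<open>g = h\<close>.\<close>
  define g where "g = min (P - k) h"
  define F where "F = v ` (J \<inter> {1..t})"
  define G where "G = w ` {1..g}"
  have g: "g \<le> h" "g \<le> m - t" "g \<le> m" using Pk h unfolding g_def by auto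
  have finG: "finite G" unfolding G_def by simp
  have cardG: "card G = g"
    unfolding G_def using w(1) g by (subst card_image) (auto intro: inj_on_subset)
  have Gw: "G \<subseteq> w ` {1..m}" unfolding G_def using g by auto
  have GU: "G \<subseteq> ksets U r" using Gw w(2) by auto
  have Gx: "x \<in> A" if "A \<in> G" for A using that star g unfolding G_def by auto
  have "(\<exists>y z. y \<in> U - {x} \<and> z \<in> U - {x} \<and> card {A \<in> G. y \<notin> A \<and> z \<notin> A} \<le> r ^ 3 * card U ^ (r - 4))
       \<or> card G \<le> ((card U - 2) choose (r - 2)) + r ^ 2 * card U ^ (r - 3)"
  proof (rule cross_intersecting_star_structure[OF U r, of F])
    show "F \<subseteq> ksets (U - {x}) r"
    proof
      fix A assume "A \<in> F"
      then obtain i where i: "i \<in> J" "A = v i" unfolding F_def by auto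
      then have "v i \<in> ksets U r" "x \<notin> v i" using v(2) unfolding J_def by blast+
      then show "A \<in> ksets (U - {x}) r" using i by (auto simp: ksets_def)
    qed
    have "inj_on v (J \<inter> {1..t})" by (rule inj_on_subset[OF v(1)]) (use t in auto)
    then show "card F = 2 * ((card U - 4) choose (r - 3)) + 1"
      unfolding F_def k_def[symmetric] using t(2) by (simp only: card_image)
    show "A \<inter> B \<noteq> {}" if AB: "A \<in> F" "B \<in> G" for A B
    proof -
      obtain i where "1 \<le> i" "i \<le> t" "A = v i" using AB unfolding F_def by auto
      moreover obtain j where "1 \<le> j" "j \<le> g" "B = w j" using AB unfolding G_def by auto
      ultimately show ?thesis using vw[of i j] g t by auto
    qed
  qed (use GU Gx in auto)
  then show ?thesis
  proof
    assume "\<exists>y z. y \<in> U - {x} \<and> z \<in> U - {x} \<and> card {A \<in> G. y \<notin> A \<and> z \<notin> A} \<le> r ^ 3 * card U ^ (r - 4)"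
    then obtain y z where yz: "y \<in> U - {x}" "z \<in> U - {x}"
      "card {A \<in> G. y \<notin> A \<and> z \<notin> A} \<le> r ^ 3 * card U ^ (r - 4)" by blast
    have parts: "card G \<le> card {A \<in> G. y \<in> A \<or> z \<in> A} + card {A \<in> G. y \<notin> A \<and> z \<notin> A}"
      using card_le_split[of G "\<lambda>A. y \<in> A \<or> z \<in> A"] by (simp only: de_Morgan_disj)
    have "{A \<in> G. y \<in> A \<or> z \<in> A} = {A \<in> G. {x, y} \<subseteq> A} \<union> {A \<in> G. {x, z} \<subseteq> A}"
      using Gx by auto
    then have "card {A \<in> G. y \<in> A \<or> z \<in> A} \<le> codeg G {x, y} + codeg G {x, z}"
      unfolding codeg_def by (simp only: card_Un_le)
    also have "\<dots> \<le> card U ^ (r - 2) + card U ^ (r - 2)"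
    proof (rule add_mono)
      have "card {x, y} = 2" "card {x, z} = 2" using yz by auto
      then show "codeg G {x, y} \<le> card U ^ (r - 2)" "codeg G {x, z} \<le> card U ^ (r - 2)"
        using codeg_le_power[OF U(1) GU, of "{x, y}"] codeg_le_power[OF U(1) GU, of "{x, z}"] r
        by simp_all
    qed
    finally have two: "card {A \<in> G. y \<in> A \<or> z \<in> A} \<le> 2 * card U ^ (r - 2)" by simp
    have "card U ^ (r - 4) \<le> card U ^ (r - 2)"
      using U by (intro power_increasing) (auto simp: Suc_le_eq card_gt_0_iff)
    then have "r ^ 3 * card U ^ (r - 4) \<le> r ^ 3 * card U ^ (r - 2)" by (rule mult_left_mono) simp
    \<comment> \<open>The sets meeting the pair number at most \<open>2 * card U ^ (r - 2)\<close>,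
      the others at most \<open>r ^ 3 * card U ^ (r - 2)\<close>: together fewer than
      \<open>h\<close>.\<close>
    then have "g < h" using cardG parts two yz(3) hbig unfolding add_mult_distrib by linarith
    then have "P - k = g" unfolding g_def by simp
    moreover have "card {A \<in> G. y \<in> A \<or> z \<in> A} \<le> card {A \<in> w ` {1..m}. x \<in> A \<and> (y \<in> A \<or> z \<in> A)}"
    proof (rule card_mono)
      show "{A \<in> G. y \<in> A \<or> z \<in> A} \<subseteq> {A \<in> w ` {1..m}. x \<in> A \<and> (y \<in> A \<or> z \<in> A)}"
        using Gw Gx by blast
    qed simp
    ultimately have "P \<le> k + card {A \<in> w ` {1..m}. x \<in> A \<and> (y \<in> A \<or> z \<in> A)}
        + r ^ 3 * card U ^ (r - 4)"
      using parts cardG yz(3) True by linarith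
    then show ?thesis using yz(1,2) by blast
  next
    assume small: "card G \<le> ((card U - 2) choose (r - 2)) + r ^ 2 * card U ^ (r - 3)"
    have "((card U - 2) choose (r - 2)) \<le> (card U - 2) ^ (r - 2)" by (rule choose_le_power)
    also have "\<dots> \<le> card U ^ (r - 2)" by (rule power_mono) auto
    finally have 1: "((card U - 2) choose (r - 2)) \<le> card U ^ (r - 2)" .
    have "card U ^ (r - 3) \<le> card U ^ (r - 2)"
      using U by (intro power_increasing) (auto simp: Suc_le_eq card_gt_0_iff)
    moreover have "r ^ 2 \<le> r ^ 3" using r by (intro power_increasing) auto
    ultimately have "r ^ 2 * card U ^ (r - 3) \<le> r ^ 3 * card U ^ (r - 2)"
      by (intro mult_mono) auto
    then have "g < h" using 1 small cardG hbig unfolding add_mult_distrib by linarith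
    then have "P - k = g" unfolding g_def by simp
    then show ?thesis using small cardG True by linarith
  qed
qed

text \<open>In the first alternative \<open>m\<close> is too small to force a common point
  \<open>x\<close>. In the second, at least one of the two sides has no pair and obeys a bound with
  one binomial \<open>(n - 2) choose (r - 2)\<close> instead of two. In the third, both sides have
  pairs and share the sets through \<open>x\<close> that meet them.\<close>

lemma opposite_sequences_bound:
  fixes U :: "'a set" and v w :: "nat \<Rightarrow> 'a set"
  assumes U: "finite U" "card U = n" and r: "r \<ge> 4"
    and v: "inj_on v {1..m}" "v ` {1..m} \<subseteq> ksets U r"
    and w: "inj_on w {1..m}" "w ` {1..m} \<subseteq> ksets U r"
    and disj: "v ` {1..m} \<inter> w ` {1..m} = {}"
    and vw: "\<And>i j. 1 \<le> i \<Longrightarrow> 1 \<le> j \<Longrightarrow> i + j \<le> m \<Longrightarrow> v i \<inter> w j \<noteq> {}"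
  shows "m div 2 \<le> (r ^ 3 + 2) * n ^ (r - 2)
       \<or> 2 * m \<le> ((n - 1) choose (r - 1)) + 3 * ((n - 2) choose (r - 2))
                 + 4 * ((n - 4) choose (r - 3)) + 2 + 2 * r ^ 3 * n ^ (r - 3)
       \<or> 2 * m + ((n - 5) choose (r - 1)) \<le> 2 * ((n - 1) choose (r - 1))
                 + 4 * ((n - 4) choose (r - 3)) + 2 + 2 * r ^ 3 * n ^ (r - 4)"
proof (cases "m div 2 \<le> (r ^ 3 + 2) * n ^ (r - 2)")
  case True
  then show ?thesis by blast
next
  case False
  define h where "h = m div 2"
  have hbig: "h > (r ^ 3 + 2) * card U ^ (r - 2)" using False U unfolding h_def by simp
  have h: "h \<le> m" "h + h \<le> m" unfolding h_def by auto
  have rr: "r ^ 2 \<le> r ^ 3 + 2"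
    using power_increasing[of 2 3 r] r by linarith
  have hbig': "h > r ^ 2 * card U ^ (r - 2)"
    using hbig mult_right_mono[OF rr, of "card U ^ (r - 2)"] by linarith
  have sub: "{1..h} \<subseteq> {1..m}" using h by auto
  have "\<exists>x\<in>U. (\<forall>a\<in>v ` {1..h}. x \<in> a) \<and> (\<forall>b\<in>w ` {1..h}. x \<in> b)"
  proof (rule large_cross_intersecting_star[OF U(1)])
    show "v ` {1..h} \<subseteq> ksets U r" "w ` {1..h} \<subseteq> ksets U r"
      using v(2) w(2) sub by blast+
    show "card (v ` {1..h}) > r ^ 2 * card U ^ (r - 2)"
      using hbig' inj_on_subset[OF v(1) sub] by (simp add: card_image)
    show "card (w ` {1..h}) > r ^ 2 * card U ^ (r - 2)"
      using hbig' inj_on_subset[OF w(1) sub] by (simp add: card_image)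
    show "a \<inter> b \<noteq> {}" if ab: "a \<in> v ` {1..h}" "b \<in> w ` {1..h}" for a b
    proof -
      obtain i j where "a = v i" "b = w j" "1 \<le> i" "i \<le> h" "1 \<le> j" "j \<le> h"
        using ab by auto
      then show ?thesis using vw[of i j] h(2) by simp
    qed
  qed (use r in simp)
  then obtain x where x0: "x \<in> U" "\<forall>a\<in>v ` {1..h}. x \<in> a" "\<forall>b\<in>w ` {1..h}. x \<in> b"
    by blast
  have x: "x \<in> U" "\<And>j. 1 \<le> j \<Longrightarrow> j \<le> h \<Longrightarrow> x \<in> v j" "\<And>j. 1 \<le> j \<Longrightarrow> j \<le> h \<Longrightarrow> x \<in> w j"
    using x0 by auto
  define P where "P = card {i \<in> {1..m}. x \<notin> v i}"
  define Q where "Q = card {i \<in> {1..m}. x \<notin> w i}"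
  define V where "V = v ` {1..m}"
  define W where "W = w ` {1..m}"
  define k where "k = 2 * ((n - 4) choose (r - 3)) + 1"
  have fin: "finite V" "finite W" unfolding V_def W_def by auto
  have VU: "V \<subseteq> ksets U r" and WU: "W \<subseteq> ksets U r" using v(2) w(2) unfolding V_def W_def by auto
  have VW: "V \<inter> W = {}" using disj unfolding V_def W_def .
  have star_part: "m \<le> codeg (u ` {1..m}) {x} + card {i \<in> {1..m}. x \<notin> u i}"
    if "inj_on u {1..m}" for u
  proof -
    have "card {1..m} \<le> card {i \<in> {1..m}. x \<in> u i} + card {i \<in> {1..m}. x \<notin> u i}"
      by (rule card_le_split)
    moreover have "card {i \<in> {1..m}. x \<in> u i} \<le> codeg (u ` {1..m}) {x}"
      unfolding codeg_def
    proof (rule card_inj_on_le[of u])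
      show "inj_on u {i \<in> {1..m}. x \<in> u i}" by (rule inj_on_subset[OF that]) auto
    qed auto
    ultimately show ?thesis by simp
  qed
  \<comment> \<open>Disjointness of \<open>V\<close> and \<open>W\<close> lets a single count of
    \<open>r\<close>-sets bound both sides together.\<close>
  have sum_le: "card {A \<in> V. R A} + card {A \<in> W. R A} \<le> card {A \<in> ksets U r. R A}" for R
  proof -
    have "card {A \<in> V. R A} + card {A \<in> W. R A} = card ({A \<in> V. R A} \<union> {A \<in> W. R A})"
      using VW fin by (subst card_Un_disjoint) auto
    also have "\<dots> \<le> card {A \<in> ksets U r. R A}"
      using VU WU finite_ksets[OF U(1)] by (intro card_mono) auto
    finally show ?thesis .
  qed
  have S: "codeg (ksets U r) {x} = (n - 1) choose (r - 1)"
    using codeg_ksets[OF U(1), of "{x}" r] x(1) U(2) r by simp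
  have main: "2 * m \<le> ((n - 1) choose (r - 1)) + P + Q"
    using star_part[OF v(1)] star_part[OF w(1)] sum_le[of "\<lambda>A. {x} \<subseteq> A"] S
    unfolding codeg_def P_def Q_def V_def W_def by linarith
  define hitting where
    "hitting G y z = card {A \<in> G. x \<in> A \<and> (y \<in> A \<or> z \<in> A)}" for G :: "'a set set" and y z
  have hit2: "hitting G y z \<le> 2 * ((n - 2) choose (r - 2))"
    if "G \<subseteq> ksets U r" "y \<in> U - {x}" "z \<in> U - {x}" for G y z
  proof -
    have "{A \<in> G. x \<in> A \<and> (y \<in> A \<or> z \<in> A)} = {A \<in> G. {x, y} \<subseteq> A} \<union> {A \<in> G. {x, z} \<subseteq> A}"
      by auto
    then have "hitting G y z \<le> codeg G {x, y} + codeg G {x, z}"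
      unfolding hitting_def codeg_def by (simp only: card_Un_le)
    moreover have "card {x, y} = 2" "card {x, z} = 2" using that by auto
    ultimately show ?thesis
      using codeg_le_choose[OF U(1) that(1), of "{x, y}"]
        codeg_le_choose[OF U(1) that(1), of "{x, z}"] U(2) r by simp
  qed
  have npos: "n \<ge> 1" using U x(1) by (auto simp: Suc_le_eq card_gt_0_iff)
  have err: "r ^ 2 * n ^ (r - 3) \<le> r ^ 3 * n ^ (r - 3)" "r ^ 3 * n ^ (r - 4) \<le> r ^ 3 * n ^ (r - 3)"
    using r npos by (auto intro!: mult_mono power_increasing)
  define c1 c2 c4 c5 p2 p3 p4 where "c1 = (n - 1) choose (r - 1)" and "c2 = (n - 2) choose (r - 2)"
    and "c4 = (n - 4) choose (r - 3)" and "c5 = (n - 5) choose (r - 1)"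
    and "p2 = r ^ 2 * n ^ (r - 3)" and "p3 = r ^ 3 * n ^ (r - 3)" and "p4 = r ^ 3 * n ^ (r - 4)"
  note folds = k_def mult.assoc c1_def[symmetric] c2_def[symmetric] c4_def[symmetric]
    c5_def[symmetric] p2_def[symmetric] p3_def[symmetric] p4_def[symmetric]
  have P_alt: "(\<exists>y z. y \<in> U - {x} \<and> z \<in> U - {x} \<and> P \<le> k + hitting W y z + r ^ 3 * n ^ (r - 4))
       \<or> P \<le> k + ((n - 2) choose (r - 2)) + r ^ 2 * n ^ (r - 3)"
    using card_missing_star[OF U(1) x(1) r v w vw x(3) h(1) hbig]
    unfolding P_def k_def W_def hitting_def U(2) .
  have Q_alt: "(\<exists>y z. y \<in> U - {x} \<and> z \<in> U - {x} \<and> Q \<le> k + hitting V y z + r ^ 3 * n ^ (r - 4))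
       \<or> Q \<le> k + ((n - 2) choose (r - 2)) + r ^ 2 * n ^ (r - 3)"
  proof -
    have wv: "w i \<inter> v j \<noteq> {}" if "1 \<le> i" "1 \<le> j" "i + j \<le> m" for i j
      using vw[of j i] that by (simp add: Int_commute add.commute)
    show ?thesis
      using card_missing_star[OF U(1) x(1) r w v wv x(2) h(1) hbig]
      unfolding Q_def k_def V_def hitting_def U(2) .
  qed
  from P_alt consider
      (P) y z where "y \<in> U - {x}" "z \<in> U - {x}" "P \<le> k + hitting W y z + r ^ 3 * n ^ (r - 4)"
    | (P') "P \<le> k + ((n - 2) choose (r - 2)) + r ^ 2 * n ^ (r - 3)"
    by blast
  then show ?thesis
  proof cases
    case P
    from Q_alt consider
        (Q) y' z' where "y' \<in> U - {x}" "z' \<in> U - {x}" "Q \<le> k + hitting V y' z' + r ^ 3 * n ^ (r - 4)"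
      | (Q') "Q \<le> k + ((n - 2) choose (r - 2)) + r ^ 2 * n ^ (r - 3)"
      by blast
    then show ?thesis
    proof cases
      case Q
      \<comment> \<open>Sets of \<open>V\<close> meeting \<open>{y', z'}\<close> and sets of
        \<open>W\<close> meeting \<open>{y, z}\<close> are distinct \<open>r\<close>-sets through
        \<open>x\<close> meeting \<open>Y\<close>, so both counts fit into one family.\<close>
      define Y where "Y = {y, z, y', z'}"
      have Y: "Y \<subseteq> U - {x}" "finite Y" using P(1,2) Q(1,2) unfolding Y_def by auto
      have cardY: "card Y \<le> 4"
        unfolding Y_def using card_length[of "[y, z, y', z']"] by simp
      have "hitting V y' z' \<le> card {A \<in> V. x \<in> A \<and> A \<inter> Y \<noteq> {}}"
        unfolding hitting_def by (rule card_mono) (use fin in \<open>auto simp: Y_def\<close>)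
      moreover have "hitting W y z \<le> card {A \<in> W. x \<in> A \<and> A \<inter> Y \<noteq> {}}"
        unfolding hitting_def by (rule card_mono) (use fin in \<open>auto simp: Y_def\<close>)
      ultimately have "hitting V y' z' + hitting W y z \<le> card {A \<in> ksets U r. x \<in> A \<and> A \<inter> Y \<noteq> {}}"
        using sum_le[of "\<lambda>A. x \<in> A \<and> A \<inter> Y \<noteq> {}"] by linarith
      moreover have "card {A \<in> ksets U r. x \<in> A \<and> A \<inter> Y \<noteq> {}} + ((n - 5) choose (r - 1))
          \<le> (n - 1) choose (r - 1)"
      proof -
        let ?I = "{A \<in> ksets U r. x \<in> A \<and> A \<inter> Y \<noteq> {}}" and ?O = "{A \<in> ksets (U - Y) r. {x} \<subseteq> A}"
        \<comment> \<open>At most four points of \<open>Y\<close> and the point \<open>x\<close>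
          itself are removed.\<close>
        have "n - 5 \<le> card (U - Y) - 1"
          using diff_card_le_card_Diff[OF Y(2), of U] U(2) cardY by linarith
        then have "((n - 5) choose (r - 1)) \<le> (card (U - Y) - 1) choose (r - 1)"
          by (rule binomial_right_mono)
        also have "\<dots> = card ?O"
        proof -
          have "finite (U - Y)" "{x} \<subseteq> U - Y" "card {x} \<le> r" using U(1) x(1) Y r by auto
          from codeg_ksets[OF this] show ?thesis unfolding codeg_def by simp
        qed
        finally have "((n - 5) choose (r - 1)) \<le> card ?O" .
        moreover have "card ?I + card ?O = card (?I \<union> ?O)"
          by (rule card_Un_disjoint[symmetric]) (use U(1) in \<open>auto simp: finite_ksets ksets_def\<close>)
        moreover have "card (?I \<union> ?O) \<le> codeg (ksets U r) {x}"
          unfolding codeg_def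
          by (rule card_mono) (use U(1) in \<open>auto simp: finite_ksets ksets_def\<close>)
        ultimately show ?thesis using S by linarith
      qed
      ultimately show ?thesis using main P(3) Q(3) unfolding folds by linarith
    next
      case Q'
      \<comment> \<open>The side with a pair costs \<open>2 * ((n - 2) choose (r - 2))\<close>, the
        other side one more such binomial: hence the coefficient 3.\<close>
      then show ?thesis using hit2[OF WU P(1,2)] P(3) main err unfolding folds by linarith
    qed
  next
    case P'
    from Q_alt consider
        (Q) y' z' where "y' \<in> U - {x}" "z' \<in> U - {x}" "Q \<le> k + hitting V y' z' + r ^ 3 * n ^ (r - 4)"
      | (Q') "Q \<le> k + ((n - 2) choose (r - 2)) + r ^ 2 * n ^ (r - 3)"
      by blast
    then show ?thesis
    proof cases
      case Q
      then show ?thesis using hit2[OF VU Q(1,2)] P' main err unfolding folds by linarith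
    next
      case Q'
      then show ?thesis using P' main err unfolding folds by linarith
    qed
  qed
qed

section \<open>Estimates of binomial coefficients\<close>

text \<open>Second-order expansion of the product, with the second elementary symmetric function of
  the \<open>c i\<close> bounded by the square of their sum. The factor \<open>x ^ 2\<close> on both
  sides avoids the exponents \<open>d - 1\<close> and \<open>d - 2\<close>, which truncate for small
  \<open>d\<close>.\<close>

lemma prod_minus_le:
  fixes x :: real and c :: "nat \<Rightarrow> real"
  assumes "x \<ge> 0" and "\<And>i. i < d \<Longrightarrow> 0 \<le> c i \<and> c i \<le> x"
  shows "(\<Prod>i<d. x - c i) * x ^ 2 \<le> x ^ d * (x ^ 2 - (\<Sum>i<d. c i) * x + (\<Sum>i<d. c i) ^ 2)"
  using assms(2)
proof (induction d)
  case 0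
  then show ?case by simp
next
  case (Suc d)
  let ?s = "\<Sum>i<d. c i"
  have cd: "0 \<le> c d" "c d \<le> x" using Suc.prems by auto
  have s: "0 \<le> ?s" using Suc.prems by (intro sum_nonneg) auto
  have "(\<Prod>i<Suc d. x - c i) * x ^ 2 = ((\<Prod>i<d. x - c i) * x ^ 2) * (x - c d)"
    by simp
  also have "\<dots> \<le> (x ^ d * (x ^ 2 - ?s * x + ?s ^ 2)) * (x - c d)"
    using Suc cd by (intro mult_right_mono) auto
  also have "\<dots> = x ^ d * ((x ^ 2 - ?s * x + ?s ^ 2) * (x - c d))" by simp
  also have "\<dots> \<le> x ^ d * (x * (x ^ 2 - (?s + c d) * x + (?s + c d) ^ 2))"
  proof (rule mult_left_mono)
    \<comment> \<open>This sum is exactly the right-hand side minus the left-hand side of the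
      inequality to be shown.\<close>
    have "0 \<le> ?s * c d * x + c d ^ 2 * x + ?s ^ 2 * c d"
      using cd s assms(1) by (intro add_nonneg_nonneg mult_nonneg_nonneg) auto
    then show "(x ^ 2 - ?s * x + ?s ^ 2) * (x - c d) \<le> x * (x ^ 2 - (?s + c d) * x + (?s + c d) ^ 2)"
      by (simp add: algebra_simps power2_eq_square)
  qed (use assms(1) in simp)
  finally show ?case by (simp add: mult_ac)
qed

lemma choose_le_power_div_fact: "real (n choose k) \<le> real n ^ k / fact k"
proof (cases "k \<le> n")
  case True
  have "(n choose k) * fact k \<le> n ^ k" by (rule binomial_fact_pow)
  then have "real (n choose k) * fact k \<le> real n ^ k"
    by (metis of_nat_fact of_nat_le_iff of_nat_mult of_nat_power)
  then show ?thesis by (simp add: field_simps)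
qed (simp add: binomial_eq_0)

text \<open>Times \<open>fact (e + 2)\<close>, the binomial is the product of the factors
  \<open>n - (s + i)\<close> for \<open>i < e + 2\<close>. The shifts \<open>s + i\<close> sum to
  the coefficient of \<open>n ^ (e + 1)\<close>; the last term bounds the square of that sum
  uniformly in \<open>s \<le> 5\<close>.\<close>

lemma choose_second_order:
  assumes "n \<ge> s + e + 2" and "s \<le> 5"
  shows "real ((n - s) choose (e + 2)) \<le>
    (real n ^ (e + 2) - (real s * (real e + 2) + (real e + 1) * (real e + 2) / 2) * real n ^ (e + 1)
       + ((real e + 2) * (real e + 11) / 2) ^ 2 * real n ^ e) / fact (e + 2)"
proof -
  let ?x = "real n" and ?c = "\<lambda>i::nat. real s + real i"
  define \<sigma> where "\<sigma> = real s * (real e + 2) + (real e + 1) * (real e + 2) / 2"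
  have x: "?x > 0" using assms by simp
  have \<sigma>: "(\<Sum>i<d. ?c i) = s * d + real d * (real d - 1) / 2" for d
    by (induction d) (auto simp: field_simps)
  have \<sigma>': "(\<Sum>i<e + 2. ?c i) = \<sigma>" unfolding \<sigma> \<sigma>_def by (simp add: algebra_simps)
  have "\<sigma> \<le> 5 * (real e + 2) + (e + 1) * (e + 2) / 2"
    unfolding \<sigma>_def using assms(2) mult_right_mono[of "real s" 5 "real e + 2"]
    by (simp add: algebra_simps)
  also have "\<dots> = (real e + 2) * (real e + 11) / 2" by (simp add: field_simps)
  finally have \<sigma>2: "\<sigma> ^ 2 \<le> ((real e + 2) * (real e + 11) / 2) ^ 2"
    by (rule power_mono) (simp add: \<sigma>_def)
  have "real ((n - s) choose (e + 2)) * fact (e + 2) = (\<Prod>i<e + 2. ?x - ?c i)"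
  proof -
    have "real ((n - s) choose (e + 2)) = (\<Prod>i<e + 2. real (n - s) - real i) / fact (e + 2)"
      unfolding binomial_gbinomial gbinomial_prod_rev atLeast0LessThan ..
    also have "(\<Prod>i<e + 2. real (n - s) - real i) = (\<Prod>i<e + 2. ?x - ?c i)"
      using assms by (intro prod.cong) (auto simp: of_nat_diff)
    finally show ?thesis by simp
  qed
  moreover have "(\<Prod>i<e + 2. ?x - ?c i) * ?x ^ 2 \<le> ?x ^ (e + 2) * (?x ^ 2 - \<sigma> * ?x + \<sigma> ^ 2)"
    using prod_minus_le[of ?x "e + 2" ?c] assms unfolding \<sigma>' by auto
  moreover have "?x ^ (e + 2) * (?x ^ 2 - \<sigma> * ?x + \<sigma> ^ 2)
      = (?x ^ (e + 2) - \<sigma> * ?x ^ (e + 1) + \<sigma> ^ 2 * ?x ^ e) * ?x ^ 2"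
    by (simp add: algebra_simps power2_eq_square)
  ultimately have "real ((n - s) choose (e + 2)) * fact (e + 2)
      \<le> ?x ^ (e + 2) - \<sigma> * ?x ^ (e + 1) + \<sigma> ^ 2 * ?x ^ e"
    using x by (metis mult_le_cancel_right_pos zero_less_power)
  also have "\<dots> \<le> ?x ^ (e + 2) - \<sigma> * ?x ^ (e + 1) + ((real e + 2) * (real e + 11) / 2) ^ 2 * ?x ^ e"
    using \<sigma>2 by (intro add_left_mono mult_right_mono) auto
  finally show ?thesis by (simp only: pos_le_divide_eq[OF fact_gt_zero] \<sigma>_def)
qed

text \<open>Pascal's rule four times. For \<open>k = r - 2\<close> it turns the number of
  \<open>r\<close>-sets through \<open>x\<close> meeting four further points into binomials of order
  \<open>n ^ (r - 2)\<close>.\<close>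

lemma choose_diff_5:
  assumes "n \<ge> 6"
  shows "(n - 1) choose (Suc k) = ((n - 2) choose k) + ((n - 3) choose k) + ((n - 4) choose k)
           + ((n - 5) choose k) + ((n - 5) choose (Suc k))"
proof -
  obtain l where "n = l + 6" using assms le_Suc_ex by (metis add.commute)
  then show ?thesis by (simp add: numeral_eq_Suc)
qed

text \<open>The coefficient of \<open>n ^ (e + 1)\<close>: the second-order terms of the four binomials contribute
  \<open>- 2 (e + 8)\<close>, and \<open>4 * ((n - 4) choose (e + 1))\<close> contributes \<open>4\<close>.\<close>

lemma precise_estimate:
  fixes n e :: nat
  assumes n: "n \<ge> e + 9"
  defines "x \<equiv> real n"
  shows "real (((n - 2) choose (e + 2)) + ((n - 3) choose (e + 2)) + ((n - 4) choose (e + 2))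
           + ((n - 5) choose (e + 2)) + 4 * ((n - 4) choose (e + 1)) + 2 + 2 * (e + 4) ^ 3 * n ^ e)
       \<le> 4 * x ^ (e + 2) / fact (e + 2) - 2 * (real e + 6) / fact (e + 1) * x ^ (e + 1)
           + 18 * (real e + 4) ^ 4 * x ^ e"
proof -
  define d where "d = real e + 2"
  define E where "E = (d * (real e + 11) / 2) ^ 2"
  have x: "x \<ge> 1" using n unfolding x_def by simp
  have f: "fact (e + 2) = d * (fact (e + 1) :: real)" unfolding d_def by (simp add: algebra_simps)
  have d: "d > 0" unfolding d_def by simp
  have fpos: "(fact (e + 1) :: real) \<ge> 1" by (rule fact_ge_1)
  have each: "real ((n - s) choose (e + 2)) \<le>
      (x ^ (e + 2) - (s * d + (d - 1) * d / 2) * x ^ (e + 1) + E * x ^ e) / fact (e + 2)"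
    if "s \<le> 5" for s
    using choose_second_order[of s e n] that n unfolding x_def d_def E_def
    by (simp add: add.commute[of 1 "real e"])
  \<comment> \<open>The values of \<open>s\<close> sum to \<open>2 + 3 + 4 + 5 = 14\<close>, and
    four copies of \<open>(d - 1) * d / 2\<close> make \<open>2 * (d - 1) * d\<close>.\<close>
  have "real ((n - 2) choose (e + 2)) + real ((n - 3) choose (e + 2)) + real ((n - 4) choose (e + 2))
      + real ((n - 5) choose (e + 2))
      \<le> (4 * x ^ (e + 2) - (14 * d + 2 * (d - 1) * d) * x ^ (e + 1) + 4 * E * x ^ e) / fact (e + 2)"
    using add_mono[OF add_mono[OF each[of 2] each[of 3]] add_mono[OF each[of 4] each[of 5]]]
    by (simp add: add_divide_distrib[symmetric] diff_divide_distrib[symmetric]) (simp add: algebra_simps)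
  also have "\<dots> = 4 * x ^ (e + 2) / fact (e + 2) - 2 * (real e + 8) / fact (e + 1) * x ^ (e + 1)
      + (4 * E / fact (e + 2)) * x ^ e"
  proof -
    have lin: "14 * d + 2 * (d - 1) * d = d * (2 * (real e + 8))" by (simp add: d_def algebra_simps)
    have frac: "(4 * X - d * c * y + 4 * E * z) / (d * g) = 4 * X / (d * g) - c / g * y + 4 * E / (d * g) * z"
      if "g > 0" for X c y z g
      using d that by (simp add: field_simps)
    show ?thesis unfolding f lin by (rule frac) (rule fact_gt_zero)
  qed
  also have "4 * E / fact (e + 2) \<le> 9 * (real e + 4) ^ 3"
  proof -
    have "4 * E / fact (e + 2) = d * (real e + 11) ^ 2 / fact (e + 1)"
    proof -
      have "4 * (d * a / 2) ^ 2 / (d * g) = d * a ^ 2 / g" if "g > 0" for a g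
        using d that by (simp add: field_simps power2_eq_square)
      then show ?thesis unfolding f E_def using fact_gt_zero by blast
    qed
    also have "\<dots> \<le> d * (real e + 11) ^ 2"
      using divide_left_mono[OF fpos, of "d * (real e + 11) ^ 2"] d fpos by simp
    \<comment> \<open>The constant 9 comes from \<open>e + 11 \<le> 3 * (e + 4)\<close>,
      squared.\<close>
    also have "\<dots> \<le> (real e + 4) * (3 * (real e + 4)) ^ 2"
      unfolding d_def by (intro mult_mono power_mono) auto
    also have "\<dots> = 9 * (real e + 4) ^ 3"
      by (simp add: power2_eq_square power3_eq_cube algebra_simps)
    finally show ?thesis .
  qed
  finally have four: "real ((n - 2) choose (e + 2)) + real ((n - 3) choose (e + 2))
      + real ((n - 4) choose (e + 2)) + real ((n - 5) choose (e + 2))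
      \<le> 4 * x ^ (e + 2) / fact (e + 2) - 2 * (real e + 8) / fact (e + 1) * x ^ (e + 1)
        + 9 * (real e + 4) ^ 3 * x ^ e"
    using x by simp
  have "real ((n - 4) choose (e + 1)) \<le> real (n - 4) ^ (e + 1) / fact (e + 1)"
    by (rule choose_le_power_div_fact)
  also have "\<dots> \<le> x ^ (e + 1) / fact (e + 1)"
    unfolding x_def by (intro divide_right_mono power_mono) auto
  finally have a: "real ((n - 4) choose (e + 1)) \<le> x ^ (e + 1) / fact (e + 1)" .
  have xe: "1 \<le> x ^ e" using x by simp
  \<comment> \<open>The constant 18 collects 9 from the four binomials, 2 from the explicit error
    term and 7 to absorb the additive 2.\<close>
  have r3: "2 \<le> 7 * (real e + 4) ^ 3" and r4: "18 * (real e + 4) ^ 3 \<le> 18 * (real e + 4) ^ 4"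
    using power_mono[of 4 "real e + 4" 3] power_increasing[of 3 4 "real e + 4"] by auto
  have "2 \<le> 7 * (real e + 4) ^ 3 * x ^ e"
    using mult_mono[OF r3 xe] by simp
  then have "2 + 11 * (real e + 4) ^ 3 * x ^ e \<le> 18 * (real e + 4) ^ 3 * x ^ e" by linarith
  also have "\<dots> \<le> 18 * (real e + 4) ^ 4 * x ^ e"
    using r4 x by (intro mult_right_mono) auto
  finally have "2 + 11 * (real e + 4) ^ 3 * x ^ e \<le> 18 * (real e + 4) ^ 4 * x ^ e" .
  moreover have "4 * (x ^ (e + 1) / fact (e + 1)) - 2 * (real e + 8) / fact (e + 1) * x ^ (e + 1)
      = - (2 * (real e + 6) / fact (e + 1) * x ^ (e + 1))"
  proof -
    have "4 * (y / g) - 2 * (a + 8) / g * y = - (2 * (a + 6) / g * y)" if "g > 0" for a y g :: real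
      using that by (simp add: field_simps)
    then show ?thesis using fact_gt_zero by blast
  qed
  ultimately show ?thesis
    using four a unfolding x_def by simp
qed

text \<open>Three of the four multiples of \<open>x ^ (e + 2) / fact (e + 2)\<close> pay for the
  first binomial. The fourth absorbs everything of order \<open>x ^ (e + 1)\<close>, where
  \<open>4 + 2 + 2 * (e + 6) = 2 * r + 10\<close> explains the threshold on
  \<open>x\<close>.\<close>

lemma crude_estimate:
  fixes n e :: nat
  defines "x \<equiv> real n" and "r \<equiv> real e + 4"
  assumes n: "x \<ge> fact (e + 2) * (2 * r ^ 3 + 2 * r + 10)"
  shows "real (3 * ((n - 2) choose (e + 2)) + 4 * ((n - 4) choose (e + 1)) + 2
           + 2 * (e + 4) ^ 3 * n ^ (e + 1))
       \<le> 4 * x ^ (e + 2) / fact (e + 2) - 2 * (real e + 6) / fact (e + 1) * x ^ (e + 1)"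
proof -
  have "1 * 1 \<le> fact (e + 2) * (2 * r ^ 3 + 2 * r + 10)"
    unfolding r_def by (intro mult_mono fact_ge_1) auto
  then have x: "x \<ge> 1" using n by simp
  have "real ((n - 2) choose (e + 2)) \<le> real (n - 2) ^ (e + 2) / fact (e + 2)"
    by (rule choose_le_power_div_fact)
  also have "\<dots> \<le> x ^ (e + 2) / fact (e + 2)"
    unfolding x_def by (intro divide_right_mono power_mono) auto
  finally have 1: "real ((n - 2) choose (e + 2)) \<le> x ^ (e + 2) / fact (e + 2)" .
  have "((n - 4) choose (e + 1)) \<le> (n - 4) ^ (e + 1)" by (rule choose_le_power)
  also have "\<dots> \<le> n ^ (e + 1)" by (rule power_mono) auto
  finally have "((n - 4) choose (e + 1)) \<le> n ^ (e + 1)" .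
  then have 2: "real ((n - 4) choose (e + 1)) \<le> x ^ (e + 1)"
    unfolding x_def by (metis of_nat_le_iff of_nat_power)
  have 3: "1 \<le> x ^ (e + 1)" using x by (rule one_le_power)
  have "2 * (real e + 6) / fact (e + 1) \<le> 2 * (real e + 6) / 1"
    by (rule divide_left_mono) (auto intro: fact_ge_1 simp del: fact_Suc)
  then have 4: "2 * (real e + 6) / fact (e + 1) * x ^ (e + 1) \<le> 2 * (real e + 6) * x ^ (e + 1)"
    using x by (intro mult_right_mono) auto
  have "(2 * r ^ 3 + 2 * r + 10) * x ^ (e + 1) \<le> x / fact (e + 2) * x ^ (e + 1)"
    using n x by (intro mult_right_mono) (auto simp: pos_le_divide_eq mult.commute simp del: fact_Suc)
  also have "\<dots> = x ^ (e + 2) / fact (e + 2)" by simp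
  finally have 5: "(2 * r ^ 3 + 2 * r + 10) * x ^ (e + 1) \<le> x ^ (e + 2) / fact (e + 2)" .
  have "real (3 * ((n - 2) choose (e + 2)) + 4 * ((n - 4) choose (e + 1)) + 2
           + 2 * (e + 4) ^ 3 * n ^ (e + 1))
      \<le> 3 * (x ^ (e + 2) / fact (e + 2)) + 4 * x ^ (e + 1) + 2 * x ^ (e + 1) + 2 * r ^ 3 * x ^ (e + 1)"
    using 1 2 3 unfolding x_def r_def by simp
  also have "\<dots> + 2 * (real e + 6) * x ^ (e + 1)
      = 3 * (x ^ (e + 2) / fact (e + 2)) + (2 * r ^ 3 + 2 * r + 10) * x ^ (e + 1)"
    unfolding r_def by (simp add: algebra_simps)
  finally show ?thesis
    using 4 5 unfolding times_divide_eq_right[of 4 "x ^ (e + 2)", symmetric] by linarith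
qed

text \<open>Follows from \<open>n - 1 \<ge> n / 2\<close>. Only the order of magnitude matters: for
  large \<open>n\<close>, \<open>(n - 1) choose (r - 1)\<close> outweighs any fixed multiple of
  \<open>n ^ (r - 2)\<close>.\<close>

lemma choose_lower_bound:
  assumes "n \<ge> k + 1" and "k \<ge> 1"
  shows "(1 / (2 * real k)) ^ k * real n ^ k \<le> real ((n - 1) choose k)"
proof -
  have "1 / (2 * real k) * real n \<le> real (n - 1) / real k"
    using assms by (simp add: field_simps of_nat_diff)
  then have "(1 / (2 * real k) * real n) ^ k \<le> (real (n - 1) / real k) ^ k"
    by (rule power_mono) simp
  also have "\<dots> \<le> real ((n - 1) choose k)"
    using assms by (intro binomial_ge_n_over_k_pow_k) simp
  finally show ?thesis by (simp only: power_mult_distrib)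
qed

section \<open>From the dilation to the two sequences, and the final bound\<close>

text \<open>\<open>v\<close> and \<open>w\<close> list the sets in the order of \<open>f\<close>,
  from the start and from the end. The positions of \<open>v i\<close> and \<open>w j\<close> differ
  by \<open>N + 1 - i - j\<close>, which exceeds the dilation as soon as
  \<open>i + j \<le> m\<close>.\<close>

lemma dilation_opposite_sequences:
  assumes f: "bij_betw f (pverts (kneser_graph n r)) {1..N}"
    and m: "int m + dilation (kneser_graph n r) f \<le> int N" "2 * m \<le> N"
  obtains v w where "inj_on v {1..m}" "v ` {1..m} \<subseteq> ksets {1..n} r"
    "inj_on w {1..m}" "w ` {1..m} \<subseteq> ksets {1..n} r" "v ` {1..m} \<inter> w ` {1..m} = {}"
    "\<And>i j. 1 \<le> i \<Longrightarrow> 1 \<le> j \<Longrightarrow> i + j \<le> m \<Longrightarrow> v i \<inter> w j \<noteq> {}"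
proof -
  define K where "K = ksets {1..n} r"
  have V: "pverts (kneser_graph n r) = K"
    by (simp add: kneser_graph_def K_def ksets_def)
  have E: "parcs (kneser_graph n r) = {(A, B). A \<in> K \<and> B \<in> K \<and> A \<inter> B = {}}"
    by (simp add: kneser_graph_def K_def ksets_def)
  define g where "g = inv_into K f"
  have g: "bij_betw g {1..N} K" using f unfolding V g_def by (rule bij_betw_inv_into)
  have fg: "f (g i) = i" if "i \<in> {1..N}" for i
    using bij_betw_inv_into_right[OF f that] unfolding V g_def .
  have gK: "g i \<in> K" if "i \<in> {1..N}" for i using bij_betwE[OF g] that by blast
  have ginj: "g i = g j \<longleftrightarrow> i = j" if "i \<in> {1..N}" "j \<in> {1..N}" for i j
    using bij_betw_imp_inj_on[OF g] that by (rule inj_on_eq_iff)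
  have finE: "finite (parcs (kneser_graph n r))"
    unfolding E by (rule finite_subset[of _ "K \<times> K"]) (auto simp: K_def finite_ksets)
  define D where "D = {\<bar>int (f v) - int (f w)\<bar> | v w. (v, w) \<in> parcs (kneser_graph n r)}"
  have "D = (\<lambda>(v, w). \<bar>int (f v) - int (f w)\<bar>) ` parcs (kneser_graph n r)"
    unfolding D_def by auto
  then have finD: "finite D" using finE by simp
  show thesis
  proof
    have lo: "i \<in> {1..N}" and hi: "N + 1 - i \<in> {1..N}" if "i \<in> {1..m}" for i
      using that m(2) by auto
    show "inj_on g {1..m}" using ginj[OF lo lo] by (intro inj_onI) blast
    show "g ` {1..m} \<subseteq> ksets {1..n} r" using gK[OF lo] unfolding K_def by blast
    \<comment> \<open>Subtraction truncates, so injectivity rests on \<open>j \<le> N\<close>, a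
      consequence of \<open>2 * m \<le> N\<close>.\<close>
    show "inj_on (\<lambda>j. g (N + 1 - j)) {1..m}"
    proof (rule inj_onI)
      fix i j assume ij: "i \<in> {1..m}" "j \<in> {1..m}" "g (N + 1 - i) = g (N + 1 - j)"
      then have "N + 1 - i = N + 1 - j" using ginj[OF hi hi] by blast
      moreover have "i \<le> N" "j \<le> N" using ij(1,2) m(2) by auto
      ultimately show "i = j" by linarith
    qed
    show "(\<lambda>j. g (N + 1 - j)) ` {1..m} \<subseteq> ksets {1..n} r"
      using gK[OF hi] unfolding K_def by blast
    show "g ` {1..m} \<inter> (\<lambda>j. g (N + 1 - j)) ` {1..m} = {}"
    proof -
      have False if ij: "i \<in> {1..m}" "j \<in> {1..m}" "g i = g (N + 1 - j)" for i j
      proof -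
        have "i = N + 1 - j" using ginj[OF lo[OF ij(1)] hi[OF ij(2)]] ij(3) by blast
        moreover have "1 \<le> i" "i \<le> m" "j \<le> m" using ij(1,2) by auto
        ultimately show False using m(2) by linarith
      qed
      then show ?thesis by blast
    qed
    show "g i \<inter> g (N + 1 - j) \<noteq> {}" if ij: "1 \<le> i" "1 \<le> j" "i + j \<le> m" for i j
    proof
      assume e: "g i \<inter> g (N + 1 - j) = {}"
      have i: "i \<in> {1..N}" and j: "N + 1 - j \<in> {1..N}" using ij m(2) by auto
      have "(g i, g (N + 1 - j)) \<in> parcs (kneser_graph n r)"
        unfolding E using e gK[OF i] gK[OF j] by simp
      then have "\<bar>int (f (g i)) - int (f (g (N + 1 - j)))\<bar> \<in> D"
        unfolding D_def by blast
      then have "\<bar>int i - int (N + 1 - j)\<bar> \<le> Max D"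
        unfolding fg[OF i] fg[OF j] using finD by (rule Max_ge[rotated])
      then have "\<bar>int i - int (N + 1 - j)\<bar> \<le> dilation (kneser_graph n r) f"
        unfolding dilation_def D_def .
      then show False using ij m by simp
    qed
  qed
qed

theorem theorem2p6:
  fixes r :: nat
  assumes "r \<ge> 4"
  shows "\<exists>n0::nat. \<forall>n\<ge>n0. \<forall>f :: nat set \<Rightarrow> nat.
    bij_betw f (pverts (kneser_graph n r)) {1..n choose r} \<longrightarrow>
    real_of_int (dilation (kneser_graph n r) f) \<ge>
      real (n choose r) - 1 / 2 * real ((n - 1) choose (r - 1))
      - 2 * (real n ^ (r - 2) / fact (r - 2))
      + (real r + 2) / fact (r - 3) * real n ^ (r - 3)
      - 9 * real r ^ 4 * real n ^ (r - 4)"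
proof -
  obtain e where r: "r = e + 4" using assms le_Suc_ex by (metis add.commute)
  have idx: "r - 1 = Suc (e + 2)" "r - 2 = e + 2" "r - 3 = e + 1" "r - 4 = e" using r by auto
  \<comment> \<open>By \<open>choose_lower_bound\<close>, \<open>(n - 1) choose (r - 1)\<close> is
    at least \<open>c * n ^ (r - 1)\<close>. \<open>X1\<close> makes this exceed the multiple of
    \<open>n ^ (r - 2)\<close> in its numerator; \<open>X2\<close> is the threshold of
    \<open>crude_estimate\<close>.\<close>
  define c where "c = (1 / (2 * real (e + 3))) ^ (e + 3)"
  have c: "c > 0" unfolding c_def by simp
  define X1 where "X1 = (4 * real r ^ 3 + 18 * real r ^ 4 + 2 * real r + 20) / c"
  define X2 where "X2 = fact (e + 2) * (2 * real r ^ 3 + 2 * real r + 10)"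
  define n0 where "n0 = max (2 * r + 10) (max (nat \<lceil>X1\<rceil>) (nat \<lceil>X2\<rceil>))"
  show ?thesis
  proof (intro exI[of _ n0] allI impI)
    fix n :: nat and f :: "nat set \<Rightarrow> nat"
    assume n: "n0 \<le> n"
      and f: "bij_betw f (pverts (kneser_graph n r)) {1..n choose r}"
    have n': "n \<ge> 2 * r + 10" "real n \<ge> X1" "real n \<ge> X2"
      using n unfolding n0_def by (auto simp: nat_le_iff ceiling_le_iff)
    define x where "x = real n"
    have x: "x \<ge> 1" using n'(1) unfolding x_def by simp
    define N where "N = n choose r"
    define S where "S = (n - 1) choose (r - 1)"
    define T where "T = 4 * x ^ (e + 2) / fact (e + 2)
      - 2 * (real e + 6) / fact (e + 1) * x ^ (e + 1) + 18 * (real e + 4) ^ 4 * x ^ e"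
    \<comment> \<open>\<open>N - B\<close> is the claimed bound: the last two alternatives for
      \<open>m\<close> will read \<open>2 * m \<le> S + R\<close> with
      \<open>R \<le> T\<close>.\<close>
    define B where "B = (real S + T) / 2"
    have pw: "x ^ e \<le> x ^ (e + 2)" "x ^ (e + 1) \<le> x ^ (e + 2)" "1 \<le> x ^ (e + 2)"
      using x by (intro power_increasing one_le_power; simp)+
    have S_large: "(4 * real r ^ 3 + 18 * real r ^ 4 + 2 * real r + 20) * x ^ (e + 2) \<le> real S"
    proof -
      have "(4 * real r ^ 3 + 18 * real r ^ 4 + 2 * real r + 20) \<le> c * x"
        using n'(2) c unfolding X1_def x_def by (simp add: pos_divide_le_eq mult.commute)
      then have "(4 * real r ^ 3 + 18 * real r ^ 4 + 2 * real r + 20) * x ^ (e + 2) \<le> c * x * x ^ (e + 2)"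
        using x by (intro mult_right_mono) auto
      also have "\<dots> = c * x ^ (e + 3)" by (simp add: power_add power3_eq_cube power2_eq_square)
      also have "\<dots> \<le> real S"
        using choose_lower_bound[of "e + 3" n] n'(1) unfolding c_def x_def S_def
        by (simp add: r add.commute[of 3 e])
      finally show ?thesis .
    qed
    have fact1: "2 * (real e + 6) / fact (e + 1) * x ^ (e + 1) \<le> 2 * (real e + 6) * x ^ (e + 2)"
    proof (rule mult_mono)
      have "2 * (real e + 6) / fact (e + 1) \<le> 2 * (real e + 6) / 1"
        by (rule divide_left_mono) (auto intro: fact_ge_1 simp del: fact_Suc)
      then show "2 * (real e + 6) / fact (e + 1) \<le> 2 * (real e + 6)" by simp
    qed (use pw x in auto)
    have fact2: "4 * x ^ (e + 2) / fact (e + 2) \<le> 4 * x ^ (e + 2)"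
    proof -
      have "4 * x ^ (e + 2) / fact (e + 2) \<le> 4 * x ^ (e + 2) / 1"
        by (rule divide_left_mono) (use x in \<open>auto intro: fact_ge_1 simp del: fact_Suc\<close>)
      then show ?thesis by simp
    qed
    have T_lower: "T \<ge> - (2 * (real e + 6) * x ^ (e + 2))"
    proof -
      have "0 \<le> 4 * x ^ (e + 2) / fact (e + 2)" "0 \<le> 18 * (real e + 4) ^ 4 * x ^ e"
        using x by auto
      then show ?thesis unfolding T_def using fact1 by linarith
    qed
    have T_upper: "T \<le> 4 * x ^ (e + 2) + 18 * real r ^ 4 * x ^ (e + 2)"
    proof -
      have "0 \<le> 2 * (real e + 6) / fact (e + 1) * x ^ (e + 1)" using x by auto
      moreover have "18 * (real e + 4) ^ 4 * x ^ e \<le> 18 * real r ^ 4 * x ^ (e + 2)"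
        unfolding r using pw x by (intro mult_mono) auto
      ultimately show ?thesis unfolding T_def using fact2 by linarith
    qed
    define X A1 A3 A4 where "X = x ^ (e + 2)" and "A1 = real r * X" and "A3 = real r ^ 3 * X"
      and "A4 = 18 * real r ^ 4 * X"
    note X_defs = X_def A1_def A3_def A4_def
    have nonneg: "1 \<le> X" "0 \<le> A1" "0 \<le> A3" "0 \<le> A4"
      using x pw(3) unfolding X_defs by auto
    have S_ge: "4 * A3 + A4 + 2 * A1 + 20 * X \<le> real S"
      using S_large unfolding X_defs by (simp only: distrib_right mult.assoc)
    have T_ge: "- (2 * A1 + 4 * X) \<le> T"
    proof -
      have "2 * (real e + 6) * x ^ (e + 2) = 2 * A1 + 4 * X"
        unfolding X_defs r by (simp add: algebra_simps)
      then show ?thesis using T_lower by simp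
    qed
    have T_le: "T \<le> 4 * X + A4" using T_upper unfolding X_defs .
    \<comment> \<open>Twice the bound on \<open>m div 2\<close> in the first alternative, plus one
      for rounding.\<close>
    have B_lower: "B \<ge> 2 * A3 + 4 * X + 1"
      unfolding B_def using S_ge T_ge nonneg by simp
    \<comment> \<open>From \<open>r * N = n * S\<close> and \<open>n \<ge> 2 * r\<close> comes
      \<open>N \<ge> 2 * S\<close>, well above \<open>2 * B = S + T\<close>. This will give
      \<open>2 * m \<le> N\<close>.\<close>
    have N_large: "2 * B + 2 \<le> real N"
    proof -
      have "r * N = n * S"
        unfolding N_def S_def by (rule times_binomial_minus1_eq) (simp add: r)
      moreover have "2 * r * S \<le> n * S" using n'(1) by (intro mult_right_mono) auto
      ultimately have "r * (2 * S) \<le> r * N" by (simp add: ac_simps)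
      then have "2 * S \<le> N" using r by simp
      then have "2 * real S \<le> real N" by (metis of_nat_le_iff of_nat_mult of_nat_numeral)
      then show ?thesis
        unfolding B_def using S_ge T_le nonneg by (simp add: field_simps)
    qed
    have "real N - B \<le> real_of_int (dilation (kneser_graph n r) f)"
    proof (rule ccontr)
      assume less: "\<not> ?thesis"
      \<comment> \<open>The least integer above \<open>B\<close>. By assumption \<open>N\<close>
        minus the dilation is an integer above \<open>B\<close>, hence at least
        \<open>m\<close>.\<close>
      define m where "m = nat (\<lfloor>B\<rfloor> + 1)"
      have "B \<ge> 0" using B_lower nonneg by simp
      then have m: "B < real m" "real m \<le> B + 1" "int m = \<lfloor>B\<rfloor> + 1"
        unfolding m_def by linarith+
      have "B < real_of_int (int N - dilation (kneser_graph n r) f)" using less by simp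
      then have "\<lfloor>B\<rfloor> < int N - dilation (kneser_graph n r) f"
        by (simp only: floor_less_iff)
      then have m1: "int m + dilation (kneser_graph n r) f \<le> int N" using m(3) by simp
      have m2: "2 * m \<le> N" using m(2) N_large by linarith
      obtain v w where vw: "inj_on v {1..m}" "v ` {1..m} \<subseteq> ksets {1..n} r"
        "inj_on w {1..m}" "w ` {1..m} \<subseteq> ksets {1..n} r" "v ` {1..m} \<inter> w ` {1..m} = {}"
        "\<And>i j. 1 \<le> i \<Longrightarrow> 1 \<le> j \<Longrightarrow> i + j \<le> m \<Longrightarrow> v i \<inter> w j \<noteq> {}"
        using dilation_opposite_sequences[OF f[folded N_def] m1 m2] by blast
      define b2 b3 b4 b5 l where "b2 = (n - 2) choose (e + 2)" and "b3 = (n - 3) choose (e + 2)"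
        and "b4 = (n - 4) choose (e + 2)" and "b5 = (n - 5) choose (e + 2)"
        and "l = (n - 4) choose (e + 1)"
      note b_defs = b2_def b3_def b4_def b5_def l_def
      define c5 where "c5 = (n - 5) choose Suc (e + 2)"
      have card_n: "card {1..n} = n" by simp
      have "m div 2 \<le> (r ^ 3 + 2) * n ^ (e + 2)
          \<or> 2 * m \<le> S + 3 * b2 + 4 * l + 2 + 2 * r ^ 3 * n ^ (e + 1)
          \<or> 2 * m + c5 \<le> 2 * S + 4 * l + 2 + 2 * r ^ 3 * n ^ e"
        using opposite_sequences_bound[OF finite_atLeastAtMost card_n assms vw]
        unfolding S_def b_defs c5_def idx .
      then consider "m div 2 \<le> (r ^ 3 + 2) * n ^ (e + 2)"
        | "2 * m \<le> S + 3 * b2 + 4 * l + 2 + 2 * r ^ 3 * n ^ (e + 1)"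
        | "2 * m + c5 \<le> 2 * S + 4 * l + 2 + 2 * r ^ 3 * n ^ e"
        by blast
      then show False
      proof cases
        case 1
        then have "m \<le> 2 * ((r ^ 3 + 2) * n ^ (e + 2)) + 1" by linarith
        then have "real m \<le> real (2 * ((r ^ 3 + 2) * n ^ (e + 2)) + 1)" by (simp only: of_nat_le_iff)
        also have "\<dots> = 2 * A3 + 4 * X + 1"
          unfolding X_defs x_def by (simp add: algebra_simps)
        finally show False using m(1) B_lower by simp
      next
        case 2
        define R where "R = 3 * b2 + 4 * l + 2 + 2 * (e + 4) ^ 3 * n ^ (e + 1)"
        have "2 * m \<le> S + R" using 2 unfolding R_def r by (simp only: add.assoc)
        then have "2 * real m \<le> real S + real R" by linarith
        moreover have "real R \<le> T"
        proof -
          have "fact (e + 2) * (2 * (real e + 4) ^ 3 + 2 * (real e + 4) + 10) \<le> x"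
            using n'(3) unfolding X2_def x_def r by (simp only: of_nat_add of_nat_numeral)
          from crude_estimate[OF this[unfolded x_def]] show ?thesis
            unfolding R_def b_defs T_def x_def by (rule order_trans) simp
        qed
        ultimately show False using m(1) unfolding B_def by simp
      next
        case 3
        define R where "R = b2 + b3 + b4 + b5 + 4 * l + 2 + 2 * (e + 4) ^ 3 * n ^ e"
        \<comment> \<open>Expanding one of the two copies of \<open>S\<close> cancels
          \<open>c5\<close> and leaves a single \<open>S\<close>.\<close>
        have "S = b2 + b3 + b4 + b5 + c5"
          unfolding S_def b_defs c5_def idx by (rule choose_diff_5) (use n'(1) in simp)
        then have "2 * m \<le> S + R" using 3 unfolding R_def r by linarith
        then have "2 * real m \<le> real S + real R" by linarith
        moreover have "real R \<le> T"
          unfolding R_def b_defs T_def x_def by (rule precise_estimate) (use n'(1) r in simp)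
        ultimately show False using m(1) unfolding B_def by simp
      qed
    qed
    \<comment> \<open>Halving \<open>T\<close> turns \<open>2 * (e + 6)\<close> into
      \<open>r + 2\<close> and 18 into 9.\<close>
    moreover have "B = 1 / 2 * real S + 2 * (x ^ (e + 2) / fact (e + 2))
        - (real r + 2) / fact (e + 1) * x ^ (e + 1) + 9 * real r ^ 4 * x ^ e"
    proof -
      have "T / 2 = 2 * (x ^ (e + 2) / fact (e + 2)) - (real r + 2) / fact (e + 1) * x ^ (e + 1)
          + 9 * real r ^ 4 * x ^ e"
        unfolding T_def r by (simp del: fact_Suc power_Suc)
      then show ?thesis unfolding B_def add_divide_distrib by linarith
    qed
    ultimately show "real_of_int (dilation (kneser_graph n r) f) \<ge>
      real (n choose r) - 1 / 2 * real ((n - 1) choose (r - 1))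
      - 2 * (real n ^ (r - 2) / fact (r - 2))
      + (real r + 2) / fact (r - 3) * real n ^ (r - 3)
      - 9 * real r ^ 4 * real n ^ (r - 4)"
      unfolding N_def[symmetric] S_def[symmetric] x_def[symmetric] unfolding idx by linarith
  qed
qed

end
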